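(* Let $\Theta_S\subsetneq\Theta_L$ be nonempty, compact, and convex subsets of $\mathbb{R}^d$, and suppose that $\theta^\star\in\Theta_S$. Then $$\lim_{\sigma\to0^+}\frac{R_\sigma(\theta^\star;\Theta_S)-R_\sigma(\theta^\star;\Theta_L)}{\sigma^2}\le0.$$
   Context: For a nonempty compact convex set $\Theta\subseteq\mathbb{R}^d$, $\Pi_\Theta(y)=\arg\min_{\theta\in\Theta}\|y-\theta\|^2$ is the Euclidean projection. For $\theta\in\Theta$ and $\sigma>0$, $R_\sigma(\theta;\Theta)=\mathbb{E}\|\Pi_\Theta(\theta+\sigma Z)-\theta\|^2$ with $Z\sim N(0,I_d)$. The statement includes that the limit exists. *)

theory Defs
  imports "HOL-Probability.Probability"
begin

text \<open>The law \<open>N(0, I\<^sub>d)\<close>, given by its Lebesgue density, the product of the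
  one-dimensional standard normal densities of the coordinates; \<open>d\<close> is \<open>CARD('d)\<close>.\<close>

definition std_gaussian :: "(real ^ 'd) measure" where
  "std_gaussian = density lborel (\<lambda>z. ennreal (\<Prod>i\<in>UNIV. std_normal_density (z $ i)))"

text \<open>The projection onto \<open>\<Theta>\<close> is the library's \<^const>\<open>closest_point\<close>, which selects a
  minimiser of the distance over \<open>\<Theta>\<close>; the minimiser exists and is unique for nonempty, closed,
  convex \<open>\<Theta>\<close>.\<close>

definition proj_risk :: "real \<Rightarrow> real ^ 'd \<Rightarrow> (real ^ 'd) set \<Rightarrow> real" where
  "proj_risk \<sigma> \<theta> \<Theta> =
     (\<integral>z. (norm (closest_point \<Theta> (\<theta> + \<sigma> *\<^sub>R z) - \<theta>))\<^sup>2 \<partial>std_gaussian)"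

end

theory Submission
  imports Defs
begin

text \<open>
  Near \<open>\<theta>\<close> a convex set looks like its tangent cone. Rescaling by \<open>1 / \<sigma>\<close> turns the projection error
  \<open>closest_point \<Theta> (\<theta> + \<sigma> z) - \<theta>\<close> into the projection of \<open>z\<close> onto \<open>(\<Theta> - \<theta>) / \<sigma>\<close>. As \<open>\<sigma>\<close> decreases
  to \<open>0\<close> these convex sets increase, and the closure of their union is the tangent cone \<open>T\<close>; hence
  the rescaled errors converge pointwise to the projection of \<open>z\<close> onto \<open>T\<close>
  (\<open>closest_point_directional_limit\<close>). The projection is nonexpansive and fixes \<open>\<theta>\<close>, so the rescaled
  errors are bounded by \<open>norm z\<close>, which has a finite second Gaussian moment. Dominated
  convergence shows that \<open>proj_risk \<sigma> \<theta> \<Theta> / \<sigma>\<^sup>2\<close> tends to the expected squared norm of the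
  projection of a Gaussian vector onto \<open>T\<close>, a quantity known as the statistical dimension of \<open>T\<close>
  (\<open>proj_risk_small_noise\<close>).

  It remains to compare the statistical dimensions of two nested cones. For a closed convex cone the
  projection of \<open>z\<close> is orthogonal to its residual, so its squared norm is \<open>(norm z)\<^sup>2\<close> minus the
  squared distance from \<open>z\<close> to the cone. The larger cone is closer to \<open>z\<close>, so it has
  the longer projection (\<open>norm_closest_point_cone_mono\<close>). This is special to cones: of two
  nested convex sets containing \<open>0\<close>, the larger one may give the shorter projection, which is why the
  comparison is made only in the limit.
\<close>

section \<open>Projection onto closed convex cones\<close>

lemma closest_point_cone_orthogonal:
  fixes C :: "'a::euclidean_space set"
  assumes "closed C" "convex C" "cone C" "C \<noteq> {}"
  shows "(z - closest_point C z) \<bullet> closest_point C z = 0"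
proof -
  let ?q = "closest_point C z"
  have q: "?q \<in> C"
    using assms closest_point_in_set by blast
  \<comment> \<open>The obtuse angle criterion is tested at the two ends of the segment from \<open>0\<close> to twice the
      projection, whose midpoint is the projection itself.\<close>
  have "0 \<in> C" "2 *\<^sub>R ?q \<in> C"
    using assms q by (auto simp: cone_contains_0 cone_def)
  then have "(z - ?q) \<bullet> (0 - ?q) \<le> 0" "(z - ?q) \<bullet> (2 *\<^sub>R ?q - ?q) \<le> 0"
    using closest_point_dot[OF assms(2,1)] by blast+
  then show ?thesis
    by (simp add: scaleR_2)
qed

lemma norm_closest_point_cone:
  fixes C :: "'a::euclidean_space set"
  assumes "closed C" "convex C" "cone C" "C \<noteq> {}"
  shows "(norm (closest_point C z))\<^sup>2 = (norm z)\<^sup>2 - (dist z (closest_point C z))\<^sup>2"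
  using closest_point_cone_orthogonal[OF assms, of z]
  by (simp add: dist_norm power2_norm_eq_inner inner_diff inner_commute)

lemma norm_closest_point_cone_mono:
  fixes C D :: "'a::euclidean_space set"
  assumes C: "closed C" "convex C" "cone C" "C \<noteq> {}"
    and D: "closed D" "convex D" "cone D"
    and "C \<subseteq> D"
  shows "norm (closest_point C z) \<le> norm (closest_point D z)"
proof -
  have "D \<noteq> {}"
    using C(4) \<open>C \<subseteq> D\<close> by auto
  have "closest_point C z \<in> D"
    using C \<open>C \<subseteq> D\<close> closest_point_in_set by blast
  then have "dist z (closest_point D z) \<le> dist z (closest_point C z)"
    by (rule closest_point_le[OF D(1)])
  then have "(dist z (closest_point D z))\<^sup>2 \<le> (dist z (closest_point C z))\<^sup>2"
    by (simp add: power_mono)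
  then have "(norm (closest_point C z))\<^sup>2 \<le> (norm (closest_point D z))\<^sup>2"
    by (simp add: norm_closest_point_cone[OF C] norm_closest_point_cone[OF D \<open>D \<noteq> {}\<close>])
  then show ?thesis
    by (simp add: power2_le_iff_abs_le)
qed

section \<open>The tangent cone as the small-scale limit of a convex set\<close>

definition tangent_cone :: "'a::euclidean_space set \<Rightarrow> 'a \<Rightarrow> 'a set" where
  "tangent_cone \<Theta> \<theta> = closure (cone hull ((\<lambda>x. x - \<theta>) ` \<Theta>))"

lemma closed_tangent_cone: "closed (tangent_cone \<Theta> \<theta>)"
  by (simp add: tangent_cone_def)

lemma cone_tangent_cone: "cone (tangent_cone \<Theta> \<theta>)"
  by (simp add: tangent_cone_def cone_closure cone_cone_hull)

lemma convex_tangent_cone: "convex \<Theta> \<Longrightarrow> convex (tangent_cone \<Theta> \<theta>)"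
  by (simp add: tangent_cone_def convex_closure convex_cone_hull convex_translation_subtract)

lemma tangent_cone_nonempty: "\<Theta> \<noteq> {} \<Longrightarrow> tangent_cone \<Theta> \<theta> \<noteq> {}"
  by (simp add: tangent_cone_def cone_hull_empty_iff[symmetric])

lemma tangent_cone_mono: "A \<subseteq> B \<Longrightarrow> tangent_cone A \<theta> \<subseteq> tangent_cone B \<theta>"
  unfolding tangent_cone_def by (intro closure_mono hull_mono image_mono)

text \<open>The projection \<open>q\<close> of \<open>z\<close> onto the tangent cone may not be a feasible direction, so the
  argument passes to feasible directions \<open>t\<close> near \<open>q\<close>. By convexity \<open>\<theta> + \<sigma> t\<close> lies in the set for all
  small \<open>\<sigma>\<close> and competes with the projection. This makes the distance from \<open>z\<close> to the
  rescaled errors converge to the distance from \<open>z\<close> to \<open>q\<close>, and the obtuse angle criterion at \<open>q\<close> upgrades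
  convergence of distances to convergence of points.\<close>

lemma closest_point_directional_limit:
  fixes \<Theta> :: "'a::euclidean_space set"
  assumes "closed \<Theta>" "convex \<Theta>" "\<theta> \<in> \<Theta>"
  shows "((\<lambda>\<sigma>. (closest_point \<Theta> (\<theta> + \<sigma> *\<^sub>R z) - \<theta>) /\<^sub>R \<sigma>) \<longlongrightarrow> closest_point (tangent_cone \<Theta> \<theta>) z)
           (at_right 0)"
proof -
  define C where "C = tangent_cone \<Theta> \<theta>"
  define q where "q = closest_point C z"
  define p where "p \<sigma> = (closest_point \<Theta> (\<theta> + \<sigma> *\<^sub>R z) - \<theta>) /\<^sub>R \<sigma>" for \<sigma> :: real
  have ne: "\<Theta> \<noteq> {}"
    using assms by auto
  have C: "closed C" "convex C" "C \<noteq> {}"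
    using assms ne
    by (simp_all add: C_def closed_tangent_cone convex_tangent_cone tangent_cone_nonempty)
  have qC: "q \<in> C"
    unfolding q_def using C closest_point_in_set by blast
  have pos: "\<forall>\<^sub>F \<sigma> in at_right 0. (0::real) < \<sigma>"
    by (rule eventually_at_right_less)
  have pC: "p \<sigma> \<in> C" if "0 < \<sigma>" for \<sigma>
  proof -
    have "closest_point \<Theta> (\<theta> + \<sigma> *\<^sub>R z) \<in> \<Theta>"
      using assms(1) ne closest_point_in_set by blast
    then have "p \<sigma> \<in> cone hull ((\<lambda>x. x - \<theta>) ` \<Theta>)"
      using that unfolding cone_hull_expl p_def
      by (auto intro!: exI[of _ "inverse \<sigma>"])
    then show ?thesis
      unfolding C_def tangent_cone_def using closure_subset by blast
  qed
  have competitor: "\<forall>\<^sub>F \<sigma> in at_right 0. dist z (p \<sigma>) \<le> dist z t"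
    if t: "t \<in> cone hull ((\<lambda>x. x - \<theta>) ` \<Theta>)" for t
  proof -
    obtain c x where cx: "t = c *\<^sub>R (x - \<theta>)" "0 \<le> c" "x \<in> \<Theta>"
      using t unfolding cone_hull_expl by auto
    have "((\<lambda>\<sigma>. \<sigma> * c) \<longlongrightarrow> 0 * c) (at_right 0)"
      by (intro tendsto_intros)
    then have "\<forall>\<^sub>F \<sigma> in at_right 0. \<sigma> * c < 1"
      by (rule order_tendstoD) simp
    then show ?thesis
      using pos
    proof eventually_elim
      fix \<sigma> :: real assume \<sigma>: "\<sigma> * c < 1" "0 < \<sigma>"
      have "(1 - \<sigma> * c) *\<^sub>R \<theta> + (\<sigma> * c) *\<^sub>R x \<in> \<Theta>"
        using \<sigma> cx assms by (intro convexD_alt) auto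
      moreover have "(1 - \<sigma> * c) *\<^sub>R \<theta> + (\<sigma> * c) *\<^sub>R x = \<theta> + \<sigma> *\<^sub>R t"
        by (simp add: cx algebra_simps)
      ultimately have le: "dist (\<theta> + \<sigma> *\<^sub>R z) (closest_point \<Theta> (\<theta> + \<sigma> *\<^sub>R z))
          \<le> dist (\<theta> + \<sigma> *\<^sub>R z) (\<theta> + \<sigma> *\<^sub>R t)"
        using closest_point_le[OF assms(1)] by metis
      have "closest_point \<Theta> (\<theta> + \<sigma> *\<^sub>R z) = \<theta> + \<sigma> *\<^sub>R p \<sigma>"
        using \<sigma> by (simp add: p_def)
      then have "\<sigma> * dist z (p \<sigma>) \<le> \<sigma> * dist z t"
        using le \<sigma> by (simp add: dist_norm flip: scaleR_diff_right)
      then show "dist z (p \<sigma>) \<le> dist z t"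
        using \<sigma> by simp
    qed
  qed
  have dist_lim: "((\<lambda>\<sigma>. dist z (p \<sigma>)) \<longlongrightarrow> dist z q) (at_right 0)"
  proof (rule order_tendstoI)
    fix a assume a: "a < dist z q"
    show "\<forall>\<^sub>F \<sigma> in at_right 0. a < dist z (p \<sigma>)"
      using pos
    proof eventually_elim
      fix \<sigma> :: real assume "0 < \<sigma>"
      then show "a < dist z (p \<sigma>)"
        using a closest_point_le[OF C(1) pC, of \<sigma> z] by (simp add: q_def)
    qed
  next
    fix a assume a: "dist z q < a"
    obtain t where t: "t \<in> cone hull ((\<lambda>x. x - \<theta>) ` \<Theta>)" "dist t q < a - dist z q"
      using qC a closure_approachable[of q] unfolding C_def tangent_cone_def
      by (meson diff_gt_0_iff_gt)
    have "dist z t < a"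
      using dist_triangle[of z t q] t(2) by (simp add: dist_commute)
    show "\<forall>\<^sub>F \<sigma> in at_right 0. dist z (p \<sigma>) < a"
      using competitor[OF t(1)] by eventually_elim (use \<open>dist z t < a\<close> in linarith)
  qed
  have "((\<lambda>\<sigma>. (dist z (p \<sigma>))\<^sup>2 - (dist z q)\<^sup>2) \<longlongrightarrow> (dist z q)\<^sup>2 - (dist z q)\<^sup>2) (at_right 0)"
    by (intro tendsto_intros dist_lim)
  then have gap: "((\<lambda>\<sigma>. (dist z (p \<sigma>))\<^sup>2 - (dist z q)\<^sup>2) \<longlongrightarrow> 0) (at_right 0)"
    by simp
  have "\<forall>\<^sub>F \<sigma> in at_right 0. (dist (p \<sigma>) q)\<^sup>2 \<le> (dist z (p \<sigma>))\<^sup>2 - (dist z q)\<^sup>2"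
    using pos
  proof eventually_elim
    fix \<sigma> :: real assume "0 < \<sigma>"
    then have "(z - q) \<bullet> (p \<sigma> - q) \<le> 0"
      using closest_point_dot[OF C(2,1) pC, of \<sigma> z] by (simp add: q_def)
    then show "(dist (p \<sigma>) q)\<^sup>2 \<le> (dist z (p \<sigma>))\<^sup>2 - (dist z q)\<^sup>2"
      by (simp add: dist_norm power2_norm_eq_inner inner_diff inner_commute)
  qed
  then have "((\<lambda>\<sigma>. (dist (p \<sigma>) q)\<^sup>2) \<longlongrightarrow> 0) (at_right 0)"
    by (intro tendsto_sandwich[OF _ _ tendsto_const gap]) auto
  then have "((\<lambda>\<sigma>. sqrt ((dist (p \<sigma>) q)\<^sup>2)) \<longlongrightarrow> sqrt 0) (at_right 0)"
    by (rule tendsto_real_sqrt)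
  then have "(p \<longlongrightarrow> q) (at_right 0)"
    by (subst tendsto_dist_iff) simp
  then show ?thesis
    by (simp add: p_def[abs_def] q_def C_def)
qed

section \<open>The second moment of the Gaussian measure\<close>

lemma borel_measurable_closest_point [measurable]:
  fixes S :: "'a::euclidean_space set"
  assumes "convex S" "closed S" "S \<noteq> {}"
  shows "closest_point S \<in> borel_measurable borel"
  by (intro borel_measurable_continuous_onI continuous_on_closest_point assms)

lemma sets_std_gaussian [measurable_cong]: "sets std_gaussian = sets borel"
  by (simp add: std_gaussian_def)

text \<open>The density is a product over the coordinates, so each coordinate's second moment factors
  into one-dimensional integrals: one second moment of the standard normal density, and its total
  mass for every other coordinate.\<close>

lemma integrable_std_gaussian_coordinate_square:
  "integrable std_gaussian (\<lambda>z :: real ^ 'd. (z $ i)\<^sup>2)"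
proof -
  define g where "g j x = std_normal_density x * (if j = i then x\<^sup>2 else 1)" for j :: 'd and x
  \<comment> \<open>The product formula for Lebesgue measure ranges over basis vectors, so \<open>f\<close> recovers the
      coordinate from its basis vector.\<close>
  define f where "f b x = ennreal (g (THE j. b = axis j 1) x)" for b :: "real ^ 'd" and x
  have [measurable]: "g j \<in> borel_measurable borel" for j
    unfolding g_def by (cases "j = i") simp_all
  have g_nonneg: "0 \<le> g j x" for j x
    by (simp add: g_def)
  have g_int: "integrable lborel (g j)" for j
    using integrable_std_normal_moment[of 2] by (cases "j = i") (simp_all add: g_def[abs_def])
  have axis: "(THE k. axis j (1::real) = axis k 1) = j" for j :: 'd
    by (simp add: axis_eq_axis)
  have Basis: "(Basis :: (real ^ 'd) set) = (\<lambda>j. axis j 1) ` UNIV"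
    by (auto simp: Basis_vec_def)
  have inj: "inj (\<lambda>j::'d. axis j (1::real))"
    by (auto simp: inj_on_def axis_eq_axis)
  have "(\<Prod>j\<in>UNIV. g j (z $ j)) = (\<Prod>j\<in>UNIV. std_normal_density (z $ j)) * (z $ i)\<^sup>2" for z
    by (simp add: g_def prod.distrib prod.delta)
  moreover have "(\<Prod>b\<in>Basis. f b (z \<bullet> b)) = ennreal (\<Prod>j\<in>UNIV. g j (z $ j))" for z
    by (simp add: Basis prod.reindex[OF inj] f_def axis inner_axis prod_ennreal g_nonneg)
  moreover have "(\<integral>\<^sup>+z. (\<Prod>b\<in>Basis. f b (z \<bullet> b)) \<partial>lborel) = (\<Prod>b\<in>Basis. \<integral>\<^sup>+x. f b x \<partial>lborel)"
    by (rule nn_integral_lborel_prod) (simp_all add: f_def[abs_def])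
  moreover have "(\<Prod>b\<in>Basis. \<integral>\<^sup>+x. f b x \<partial>lborel) = ennreal (\<Prod>j\<in>UNIV. \<integral>x. g j x \<partial>lborel)"
    by (simp add: Basis prod.reindex[OF inj] f_def axis nn_integral_eq_integral g_int g_nonneg
        prod_ennreal integral_nonneg)
  ultimately have "(\<integral>\<^sup>+z. ennreal ((\<Prod>j\<in>UNIV. std_normal_density (z $ j)) * (z $ i)\<^sup>2) \<partial>lborel)
      = ennreal (\<Prod>j\<in>UNIV. \<integral>x. g j x \<partial>lborel)"
    by simp
  then have "integrable lborel (\<lambda>z :: real ^ 'd. (\<Prod>j\<in>UNIV. std_normal_density (z $ j)) * (z $ i)\<^sup>2)"
    by (intro integrableI_nn_integral_finite) (auto simp: prod_nonneg)
  then show ?thesis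
    unfolding std_gaussian_def by (subst integrable_density) (auto simp: prod_nonneg)
qed

lemma integrable_std_gaussian_norm_square:
  "integrable std_gaussian (\<lambda>z :: real ^ 'd. (norm z)\<^sup>2)"
proof -
  have "(norm z)\<^sup>2 = (\<Sum>i\<in>UNIV. (z $ i)\<^sup>2)" for z :: "real ^ 'd"
    by (simp add: norm_vec_def L2_set_def sum_nonneg)
  then show ?thesis
    by (simp add: integrable_std_gaussian_coordinate_square)
qed

section \<open>Small-noise asymptotics of the projection risk\<close>

text \<open>Since the projection is nonexpansive and fixes \<open>\<theta>\<close>, one integrable function dominates the
  rescaled squared errors at every noise level.\<close>

lemma norm_rescaled_projection_error_le:
  fixes \<Theta> :: "'a::euclidean_space set"
  assumes "closed \<Theta>" "convex \<Theta>" "\<theta> \<in> \<Theta>" "0 < \<sigma>"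
  shows "norm ((closest_point \<Theta> (\<theta> + \<sigma> *\<^sub>R z) - \<theta>) /\<^sub>R \<sigma>) \<le> norm z"
proof -
  have "dist (closest_point \<Theta> (\<theta> + \<sigma> *\<^sub>R z)) (closest_point \<Theta> \<theta>) \<le> dist (\<theta> + \<sigma> *\<^sub>R z) \<theta>"
    using assms by (intro closest_point_lipschitz) auto
  then have "norm (closest_point \<Theta> (\<theta> + \<sigma> *\<^sub>R z) - \<theta>) \<le> \<sigma> * norm z"
    using assms by (simp add: closest_point_self dist_norm)
  then show ?thesis
    using \<open>0 < \<sigma>\<close> by (simp add: inverse_eq_divide pos_divide_le_eq mult.commute)
qed

lemma proj_risk_small_noise:
  fixes \<Theta> :: "(real ^ 'd) set"
  assumes \<Theta>: "closed \<Theta>" "convex \<Theta>" "\<theta> \<in> \<Theta>"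
  defines "T \<equiv> tangent_cone \<Theta> \<theta>"
  shows "((\<lambda>\<sigma>. proj_risk \<sigma> \<theta> \<Theta> / \<sigma>\<^sup>2) \<longlongrightarrow> (\<integral>z. (norm (closest_point T z))\<^sup>2 \<partial>std_gaussian))
           (at_right 0)"
    and "integrable std_gaussian (\<lambda>z. (norm (closest_point T z))\<^sup>2)"
proof -
  define e where "e \<sigma> z = (norm ((closest_point \<Theta> (\<theta> + \<sigma> *\<^sub>R z) - \<theta>) /\<^sub>R \<sigma>))\<^sup>2" for \<sigma> z
  have ne: "\<Theta> \<noteq> {}"
    using \<Theta> by auto
  have [measurable]: "closest_point \<Theta> \<in> borel_measurable borel"
    using \<Theta> ne by (intro borel_measurable_closest_point)
  have [measurable]: "closest_point T \<in> borel_measurable borel"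
    using \<Theta> ne unfolding T_def
    by (intro borel_measurable_closest_point convex_tangent_cone closed_tangent_cone
        tangent_cone_nonempty)
  have risk: "proj_risk \<sigma> \<theta> \<Theta> / \<sigma>\<^sup>2 = (\<integral>z. e \<sigma> z \<partial>std_gaussian)" for \<sigma>
    by (simp add: proj_risk_def e_def power_mult_distrib divide_inverse power_inverse mult.commute)
  have bound: "\<forall>\<^sub>F t in at_top. AE z in std_gaussian. norm (e (inverse t) z) \<le> (norm z)\<^sup>2"
    using eventually_gt_at_top[of 0]
  proof eventually_elim
    fix t :: real assume "0 < t"
    then show "AE z in std_gaussian. norm (e (inverse t) z) \<le> (norm z)\<^sup>2"
      using norm_rescaled_projection_error_le[OF \<Theta>, of "inverse t"]
      by (intro always_eventually allI) (simp add: e_def power_mono del: norm_scaleR)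
  qed
  have lim: "((\<lambda>t. e (inverse t) z) \<longlongrightarrow> (norm (closest_point T z))\<^sup>2) at_top" for z
    using closest_point_directional_limit[OF \<Theta>, of z]
    unfolding e_def T_def filterlim_at_right_to_top by (intro tendsto_intros)
  have "((\<lambda>t. \<integral>z. e (inverse t) z \<partial>std_gaussian)
      \<longlongrightarrow> (\<integral>z. (norm (closest_point T z))\<^sup>2 \<partial>std_gaussian)) at_top"
    by (rule integral_dominated_convergence_at_top
        [where s = "\<lambda>t. e (inverse t)", OF _ _ integrable_std_gaussian_norm_square _ bound])
       (simp_all add: lim, simp_all add: e_def[abs_def])
  then show "((\<lambda>\<sigma>. proj_risk \<sigma> \<theta> \<Theta> / \<sigma>\<^sup>2) \<longlongrightarrow> (\<integral>z. (norm (closest_point T z))\<^sup>2 \<partial>std_gaussian))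
      (at_right 0)"
    by (simp add: filterlim_at_right_to_top risk)
  show "integrable std_gaussian (\<lambda>z. (norm (closest_point T z))\<^sup>2)"
    by (rule integrable_dominated_convergence_at_top
        [where s = "\<lambda>t. e (inverse t)", OF _ _ integrable_std_gaussian_norm_square _ bound])
       (simp_all add: lim, simp_all add: e_def[abs_def])
qed

theorem theorem2p1:
  fixes \<Theta>S \<Theta>L :: "(real ^ 'd) set" and \<theta> :: "real ^ 'd"
  assumes "\<Theta>S \<noteq> {}" and "compact \<Theta>S" and "convex \<Theta>S"
    and "\<Theta>L \<noteq> {}" and "compact \<Theta>L" and "convex \<Theta>L"
    and "\<Theta>S \<subset> \<Theta>L"
    and "\<theta> \<in> \<Theta>S"
  shows "\<exists>l::real. ((\<lambda>\<sigma>. (proj_risk \<sigma> \<theta> \<Theta>S - proj_risk \<sigma> \<theta> \<Theta>L) / \<sigma>\<^sup>2) \<longlongrightarrow> l) (at_right 0)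
           \<and> l \<le> 0"
proof -
  define S where "S = tangent_cone \<Theta>S \<theta>"
  define L where "L = tangent_cone \<Theta>L \<theta>"
  let ?r = "\<lambda>C. \<integral>z. (norm (closest_point C z))\<^sup>2 \<partial>std_gaussian"
  have \<Theta>S: "closed \<Theta>S" "convex \<Theta>S" "\<theta> \<in> \<Theta>S"
    using assms compact_imp_closed by auto
  have \<Theta>L: "closed \<Theta>L" "convex \<Theta>L" "\<theta> \<in> \<Theta>L"
    using assms compact_imp_closed by auto
  have "norm (closest_point S z) \<le> norm (closest_point L z)" for z
    unfolding S_def L_def using assms
    by (intro norm_closest_point_cone_mono closed_tangent_cone convex_tangent_cone
        cone_tangent_cone tangent_cone_nonempty tangent_cone_mono) auto
  then have "?r S \<le> ?r L"
    unfolding S_def L_def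
    by (intro integral_mono proj_risk_small_noise(2)[OF \<Theta>S] proj_risk_small_noise(2)[OF \<Theta>L]
        power_mono) auto
  moreover have "((\<lambda>\<sigma>. (proj_risk \<sigma> \<theta> \<Theta>S - proj_risk \<sigma> \<theta> \<Theta>L) / \<sigma>\<^sup>2) \<longlongrightarrow> ?r S - ?r L) (at_right 0)"
    unfolding diff_divide_distrib S_def L_def
    by (intro tendsto_diff proj_risk_small_noise(1) \<Theta>S \<Theta>L)
  ultimately show ?thesis
    by (intro exI[of _ "?r S - ?r L"]) simp
qed

end
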